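(* Let $G$ be a graph such that $\Delta(G) < \mathrm{sn}(G)$. Then $\mathrm{cart}(G) \geq 3\,\mathrm{sn}(G) - |V(G)|$.
   Context: A graph is a finite, connected, loopless multigraph (multiple edges allowed); $V(G)$ is its vertex set and $\Delta(G)$ its maximum degree. A scramble $\mathcal{S}$ on $G$ is a nonempty collection (set) of nonempty connected subgraphs of $G$, called eggs; its size $|\mathcal{S}|$ is the number of eggs. The hitting number $h(\mathcal{S})$ is the minimum size of a set of vertices meeting the vertex set of every egg. An egg-cut is a set of edges whose deletion disconnects $G$ so that two different components each contain an egg; the egg-cut number $e(\mathcal{S})$ is the minimum size of an egg-cut, with $e(\mathcal{S})=\infty$ if none exists. The order is $\|\mathcal{S}\|=\min\{h(\mathcal{S}),e(\mathcal{S})\}$. The scramble number $\mathrm{sn}(G)$ is the maximum order of a scramble on $G$. The carton number is $\mathrm{cart}(G)=\min\{|\mathcal{S}| : \mathcal{S}\text{ a scramble on }G,\ \|\mathcal{S}\|=\mathrm{sn}(G)\}$.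
   Formalization: The graph G is additionally assumed not to consist of a single vertex: for the one-vertex graph, sn(G) = 1 > 0 = Δ(G) and cart(G) = 1, but 3 sn(G) − |V(G)| = 2, so the claim fails there. *)

theory Defs
  imports Main "HOL-Library.Extended_Nat"
begin

record ('v, 'e) mgraph =
  mverts :: "'v set"
  medges :: "'e set"
  mends :: "'e \<Rightarrow> 'v set"

text \<open>Edges have an identity of their own, so parallel edges are distinct edges with the same
  two-element set of endpoints.\<close>

locale loopless_multigraph =
  fixes G :: "('v, 'e) mgraph"
  assumes finite_mverts: "finite (mverts G)"
    and finite_medges: "finite (medges G)"
    and mends_subset: "e \<in> medges G \<Longrightarrow> mends G e \<subseteq> mverts G"
    and card_mends: "e \<in> medges G \<Longrightarrow> card (mends G e) = 2"

definition madj :: "('v, 'e) mgraph \<Rightarrow> 'v \<Rightarrow> 'v \<Rightarrow> bool" where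
  "madj G u v \<longleftrightarrow> (\<exists>e\<in>medges G. mends G e = {u, v})"

definition mconnected :: "('v, 'e) mgraph \<Rightarrow> bool" where
  "mconnected G \<longleftrightarrow> mverts G \<noteq> {} \<and> (\<forall>u\<in>mverts G. \<forall>v\<in>mverts G. (madj G)\<^sup>*\<^sup>* u v)"

text \<open>The endpoint map of a subgraph is required to be that of \<open>G\<close> everywhere, not only on the
  edges of the subgraph; a subgraph is then determined by its vertices and edges, so that
  cardinalities of sets of subgraphs are the intended ones.\<close>

definition msubgraph :: "('v, 'e) mgraph \<Rightarrow> ('v, 'e) mgraph \<Rightarrow> bool" where
  "msubgraph H G \<longleftrightarrow> mverts H \<subseteq> mverts G \<and> medges H \<subseteq> medges G \<and> mends H = mends G \<and>
     (\<forall>e\<in>medges H. mends H e \<subseteq> mverts H)"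

definition mcomponent :: "('v, 'e) mgraph \<Rightarrow> ('v, 'e) mgraph \<Rightarrow> bool" where
  "mcomponent C G \<longleftrightarrow> msubgraph C G \<and> mconnected C \<and>
     (\<forall>D. msubgraph D G \<and> mconnected D \<and> msubgraph C D \<longrightarrow> D = C)"

definition del_medges :: "('v, 'e) mgraph \<Rightarrow> 'e set \<Rightarrow> ('v, 'e) mgraph" where
  "del_medges G F = G\<lparr>medges := medges G - F\<rparr>"

definition mdegree :: "('v, 'e) mgraph \<Rightarrow> 'v \<Rightarrow> nat" where
  "mdegree G v = card {e \<in> medges G. v \<in> mends G e}"

definition max_mdegree :: "('v, 'e) mgraph \<Rightarrow> nat" where
  "max_mdegree G = Max (mdegree G ` mverts G)"

text \<open>Eggs are nonempty because \<^const>\<open>mconnected\<close> requires a vertex.\<close>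

definition scramble :: "('v, 'e) mgraph \<Rightarrow> ('v, 'e) mgraph set \<Rightarrow> bool" where
  "scramble G S \<longleftrightarrow> S \<noteq> {} \<and> (\<forall>A\<in>S. msubgraph A G \<and> mconnected A)"

definition hitting_set :: "('v, 'e) mgraph \<Rightarrow> ('v, 'e) mgraph set \<Rightarrow> 'v set \<Rightarrow> bool" where
  "hitting_set G S X \<longleftrightarrow> X \<subseteq> mverts G \<and> (\<forall>A\<in>S. X \<inter> mverts A \<noteq> {})"

definition hitting_number :: "('v, 'e) mgraph \<Rightarrow> ('v, 'e) mgraph set \<Rightarrow> nat" where
  "hitting_number G S = Min {card X | X. hitting_set G S X}"

definition egg_cut :: "('v, 'e) mgraph \<Rightarrow> ('v, 'e) mgraph set \<Rightarrow> 'e set \<Rightarrow> bool" where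
  "egg_cut G S F \<longleftrightarrow> F \<subseteq> medges G \<and>
     (\<exists>C D. mcomponent C (del_medges G F) \<and> mcomponent D (del_medges G F) \<and> C \<noteq> D \<and>
        (\<exists>A\<in>S. msubgraph A C) \<and> (\<exists>B\<in>S. msubgraph B D))"

text \<open>The infimum of the empty set in \<^typ>\<open>enat\<close> is \<open>\<infinity>\<close>.\<close>

definition egg_cut_number :: "('v, 'e) mgraph \<Rightarrow> ('v, 'e) mgraph set \<Rightarrow> enat" where
  "egg_cut_number G S = Inf {enat (card F) | F. egg_cut G S F}"

text \<open>The minimum is at most the hitting number, hence finite.\<close>

definition scramble_order :: "('v, 'e) mgraph \<Rightarrow> ('v, 'e) mgraph set \<Rightarrow> nat" where
  "scramble_order G S = the_enat (min (enat (hitting_number G S)) (egg_cut_number G S))"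

text \<open>A finite graph has finitely many subgraphs, hence finitely many scrambles, so the maximum and
  the minimum below range over finite sets.\<close>

definition scramble_number :: "('v, 'e) mgraph \<Rightarrow> nat" where
  "scramble_number G = Max {scramble_order G S | S. scramble G S}"

definition carton_number :: "('v, 'e) mgraph \<Rightarrow> nat" where
  "carton_number G =
     Min {card S | S. scramble G S \<and> scramble_order G S = scramble_number G}"

end

theory Submission imports Defs begin

text \<open>An egg with a single vertex would be separated from any egg missing that vertex by deleting
  the at most \<open>\<Delta>(G) < sn(G)\<close> edges at the vertex; so in a scramble of maximum order every egg has
  at least two vertices. The vertex sets of the eggs then form a hypergraph with \<open>|V(G)|\<close> vertices
  and \<open>|S|\<close> edges, all of size at least two, and the Chvatal-McDiarmid bound gives a hitting set
  with at most \<open>(|V(G)| + |S|) / 3\<close> elements.\<close>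

section \<open>Small transversals of finite hypergraphs\<close>

text \<open>Greedy choice of vertices lying in at least two sets, until the remaining sets are
  pairwise disjoint. The family is indexed by \<open>f\<close> because distinct eggs may share a
  vertex set and must be counted separately.\<close>

lemma ex_small_transversal:
  assumes "finite V" "finite S" "\<forall>A\<in>S. f A \<subseteq> V \<and> 2 \<le> card (f A)"
  shows "\<exists>X\<subseteq>V. (\<forall>A\<in>S. X \<inter> f A \<noteq> {}) \<and> 3 * card X \<le> card V + card S"
  using assms
proof (induction "card V" arbitrary: V S rule: less_induct)
  case less
  show ?case
  proof (cases "\<exists>v A B. A \<in> S \<and> B \<in> S \<and> A \<noteq> B \<and> v \<in> f A \<and> v \<in> f B")
    case True
    then obtain v A B where v: "A \<in> S" "B \<in> S" "A \<noteq> B" "v \<in> f A" "v \<in> f B"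
      by blast
    \<comment> \<open>Choosing \<open>v\<close> costs 3 on the left-hand side; passing to
      \<open>V - {v}\<close> and \<open>T\<close> lowers the right-hand side by one vertex and at
      least the two indices \<open>A\<close> and \<open>B\<close>.\<close>
    define T where "T = {C \<in> S. v \<notin> f C}"
    have vV: "v \<in> V"
      using v less.prems(3) by blast
    have cV: "card V = Suc (card (V - {v}))"
      using vV less.prems(1) by (metis card_Suc_Diff1)
    have "card {A, B} \<le> card (S - T)"
      using v less.prems(2) by (intro card_mono) (auto simp: T_def)
    moreover have "card S = card (S - T) + card T"
      using less.prems(2)
      by (metis (no_types, lifting) T_def card_Int_Diff add.commute inf.absorb2 mem_Collect_eq subsetI)
    ultimately have cS: "card T + 2 \<le> card S"
      using v(3) by simp
    have "finite T" "\<forall>C\<in>T. f C \<subseteq> V - {v} \<and> 2 \<le> card (f C)"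
      using less.prems by (auto simp: T_def)
    with less.hyps[of "V - {v}" T] cV less.prems(1)
    obtain X where X: "X \<subseteq> V - {v}" "\<forall>C\<in>T. X \<inter> f C \<noteq> {}"
      "3 * card X \<le> card (V - {v}) + card T"
      by auto
    have "card (insert v X) \<le> Suc (card X)"
      by (rule card_insert_le_m1) auto
    then have "3 * card (insert v X) \<le> card V + card S"
      using X(3) cV cS by linarith
    moreover have "\<forall>C\<in>S. insert v X \<inter> f C \<noteq> {}"
      using X(2) by (auto simp: T_def)
    ultimately show ?thesis
      using X(1) vV by (intro exI[of _ "insert v X"]) auto
  next
    case False
    have ne: "f A \<noteq> {}" if "A \<in> S" for A
      using less.prems(3) that by fastforce
    \<comment> \<open>The sets are now disjoint, so one point from each suffices: disjointness and
      size at least 2 give \<open>2 * card S \<le> card V\<close>, and adding \<open>card S\<close>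
      yields the bound.\<close>
    define g where "g A = (SOME x. x \<in> f A)" for A
    have g: "g A \<in> f A" if "A \<in> S" for A
      using ne[OF that] by (simp add: g_def some_in_eq)
    have fin: "finite (f A)" if "A \<in> S" for A
      using less.prems that finite_subset by blast
    have "2 * card S = (\<Sum>A\<in>S. 2)"
      by simp
    also have "\<dots> \<le> (\<Sum>A\<in>S. card (f A))"
      using less.prems(3) by (intro sum_mono) auto
    also have "\<dots> = card (\<Union>A\<in>S. f A)"
      using less.prems(2) fin False by (intro card_UN_disjoint[symmetric]) blast+
    also have "\<dots> \<le> card V"
      using less.prems by (intro card_mono) auto
    finally have "2 * card S \<le> card V" .
    moreover have "card (g ` S) \<le> card S"
      using less.prems(2) by (rule card_image_le)
    ultimately have "3 * card (g ` S) \<le> card V + card S"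
      by linarith
    then show ?thesis
      using g less.prems(3) by (intro exI[of _ "g ` S"]) blast
  qed
qed

section \<open>Subgraphs and components\<close>

lemma msubgraph_refl: "loopless_multigraph G \<Longrightarrow> msubgraph G G"
  by (simp add: msubgraph_def loopless_multigraph.mends_subset)

lemma msubgraph_self:
  assumes "msubgraph H G"
  shows "msubgraph H H"
proof -
  have "\<forall>e\<in>medges H. mends H e \<subseteq> mverts H"
    using assms unfolding msubgraph_def by blast
  then show ?thesis
    by (simp add: msubgraph_def)
qed

lemma msubgraph_trans: "msubgraph H K \<Longrightarrow> msubgraph K G \<Longrightarrow> msubgraph H G"
  unfolding msubgraph_def by (metis subset_trans)

text \<open>\<open>msubgraph\<close> fixes the endpoint map everywhere, so a subgraph is determined
  by its vertex set and its edge set.\<close>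

lemma finite_msubgraphs:
  assumes "loopless_multigraph G"
  shows "finite {H. msubgraph H G}"
proof -
  have "{H. msubgraph H G} \<subseteq>
      (\<lambda>(V, E). \<lparr>mverts = V, medges = E, mends = mends G\<rparr>) ` (Pow (mverts G) \<times> Pow (medges G))"
  proof
    fix H assume "H \<in> {H. msubgraph H G}"
    then show "H \<in> (\<lambda>(V, E). \<lparr>mverts = V, medges = E, mends = mends G\<rparr>) `
        (Pow (mverts G) \<times> Pow (medges G))"
      by (intro image_eqI[of _ _ "(mverts H, medges H)"]) (auto simp: msubgraph_def)
  qed
  then show ?thesis
    by (rule finite_subset) (use assms in \<open>simp add: loopless_multigraph_def\<close>)
qed

lemma loopless_multigraph_del_medges:
  "loopless_multigraph G \<Longrightarrow> loopless_multigraph (del_medges G F)"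
  by (simp add: loopless_multigraph_def del_medges_def)

text \<open>Among the finitely many connected subgraphs containing \<open>B\<close>, one that
  maximizes the number of vertices plus edges is maximal for \<open>msubgraph\<close>.\<close>

lemma ex_mcomponent:
  assumes "loopless_multigraph G" "msubgraph B G" "mconnected B"
  shows "\<exists>D. mcomponent D G \<and> msubgraph B D"
proof -
  let ?P = "\<lambda>D. msubgraph D G \<and> mconnected D \<and> msubgraph B D"
  let ?m = "\<lambda>D :: ('a, 'b) mgraph. card (mverts D) + card (medges D)"
  have fin: "finite (mverts D)" "finite (medges D)" if D: "msubgraph D G" for D
  proof -
    have "mverts D \<subseteq> mverts G" "medges D \<subseteq> medges G"
      using D by (simp_all add: msubgraph_def)
    then show "finite (mverts D)" "finite (medges D)"
      using loopless_multigraph.finite_mverts[OF assms(1)]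
        loopless_multigraph.finite_medges[OF assms(1)] by (blast intro: finite_subset)+
  qed
  have "?P B"
    using assms by (simp add: msubgraph_self)
  moreover have "finite {D. ?P D}"
    using finite_msubgraphs[OF assms(1)] by (rule rev_finite_subset) auto
  ultimately have "Max (?m ` {D. ?P D}) \<in> ?m ` {D. ?P D}"
    by (intro Max_in) blast+
  then obtain D where D: "?P D" and "Max (?m ` {D. ?P D}) = ?m D"
    by (elim imageE CollectE)
  then have max: "?m K \<le> ?m D" if "?P K" for K
    using Max_ge[of "?m ` {D. ?P D}" "?m K"] \<open>finite {D. ?P D}\<close> that by simp
  have "K = D" if K: "msubgraph K G" "mconnected K" "msubgraph D K" for K
  proof -
    have le: "?m K \<le> ?m D"
      using D K by (intro max conjI) (simp_all add: msubgraph_trans[of B D K])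
    have sub: "mverts D \<subseteq> mverts K" "medges D \<subseteq> medges K" "mends D = mends K"
      using K(3) by (simp_all add: msubgraph_def)
    have "card (mverts D) \<le> card (mverts K)" "card (medges D) \<le> card (medges K)"
      using sub fin[OF K(1)] by (auto intro: card_mono)
    with le have "card (mverts D) = card (mverts K)" "card (medges D) = card (medges K)"
      by linarith+
    then have "mverts D = mverts K" "medges D = medges K"
      using sub fin[OF K(1)] by (simp_all add: card_subset_eq)
    then show ?thesis
      using sub(3) by (intro mgraph.equality) auto
  qed
  then have "mcomponent D G"
    using D by (simp add: mcomponent_def)
  then show ?thesis
    using D by blast
qed

section \<open>Separating a single vertex from an egg\<close>

text \<open>The first step of a walk from \<open>v\<close> to another vertex uses an edge at
  \<open>v\<close>.\<close>

lemma mconnected_ex_incident: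
  assumes "mconnected G" "v \<in> mverts G" "mverts G \<noteq> {v}"
  shows "\<exists>e\<in>medges G. v \<in> mends G e"
proof -
  obtain u where "u \<in> mverts G" "u \<noteq> v"
    using assms by blast
  then have "(madj G)\<^sup>*\<^sup>* v u"
    using assms by (auto simp: mconnected_def)
  then show ?thesis
    using \<open>u \<noteq> v\<close> by (cases rule: converse_rtranclpE) (auto simp: madj_def)
qed

lemma msubgraph_singleton_medges:
  assumes "loopless_multigraph G" "msubgraph H G" "mverts H = {v}"
  shows "medges H = {}"
proof (rule equals0I)
  fix e assume "e \<in> medges H"
  then have "card (mends G e) = 2" "mends G e \<subseteq> {v}"
    using assms unfolding msubgraph_def loopless_multigraph_def by (metis subsetD, metis)
  then show False
    using card_mono[of "{v}" "mends G e"] by simp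
qed

text \<open>A connected subgraph containing \<open>v\<close> and a further vertex would have an edge
  at \<open>v\<close>; on the vertex set \<open>{v}\<close> alone, looplessness rules out every
  edge.\<close>

lemma mcomponent_isolated:
  assumes "loopless_multigraph G" "v \<in> mverts G" "\<And>e. e \<in> medges G \<Longrightarrow> v \<notin> mends G e"
  shows "mcomponent \<lparr>mverts = {v}, medges = {}, mends = mends G\<rparr> G" (is "mcomponent ?C G")
proof -
  have "D = ?C" if D: "msubgraph D G" "mconnected D" "msubgraph ?C D" for D
  proof -
    have vD: "v \<in> mverts D" and ends: "mends D = mends G" and "medges D \<subseteq> medges G"
      using D by (simp_all add: msubgraph_def)
    then have V: "mverts D = {v}"
      using mconnected_ex_incident[OF D(2) vD] assms(3) by (metis subsetD)
    then show ?thesis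
      using msubgraph_singleton_medges[OF assms(1) D(1) V] ends by (intro mgraph.equality) simp_all
  qed
  moreover have "msubgraph ?C G" "mconnected ?C"
    using assms(2) by (simp_all add: msubgraph_def mconnected_def)
  ultimately show ?thesis
    by (simp add: mcomponent_def)
qed

text \<open>Deleting the star of \<open>v\<close> makes \<open>v\<close> a component by itself,
  which contains \<open>A\<close>. No edge of \<open>B\<close> is deleted, so \<open>B\<close> stays
  connected and lies in another component.\<close>

lemma egg_cut_singleton_egg:
  assumes G: "loopless_multigraph G" and S: "scramble G S"
    and A: "A \<in> S" "mverts A = {v}" and B: "B \<in> S" "v \<notin> mverts B"
  shows "egg_cut G S {e \<in> medges G. v \<in> mends G e}"
proof -
  let ?F = "{e \<in> medges G. v \<in> mends G e}"
  let ?H = "del_medges G ?F"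
  let ?C = "\<lparr>mverts = {v}, medges = {}, mends = mends G\<rparr>"
  have sub: "msubgraph A G" "msubgraph B G" and conB: "mconnected B"
    using S A(1) B(1) unfolding scramble_def by blast+
  have H: "loopless_multigraph ?H"
    using G by (rule loopless_multigraph_del_medges)
  have "mcomponent \<lparr>mverts = {v}, medges = {}, mends = mends ?H\<rparr> ?H"
    using sub(1) A(2) by (intro mcomponent_isolated[OF H]) (simp_all add: del_medges_def msubgraph_def)
  then have C: "mcomponent ?C ?H"
    by (simp add: del_medges_def)
  have ends: "mends B = mends G" "medges B \<subseteq> medges G" "mverts B \<subseteq> mverts G"
    "\<forall>e\<in>medges B. mends B e \<subseteq> mverts B"
    using sub(2) unfolding msubgraph_def by blast+
  then have "medges B \<subseteq> medges G - ?F"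
    using B(2) by fastforce
  then have "msubgraph B ?H"
    using ends by (simp add: msubgraph_def del_medges_def)
  then obtain D where D: "mcomponent D ?H" "msubgraph B D"
    using ex_mcomponent[OF H] conB by blast
  have "?C \<noteq> D"
  proof
    assume "?C = D"
    then have "mverts B \<subseteq> {v}"
      using D(2) unfolding msubgraph_def by force
    then show False
      using B(2) conB unfolding mconnected_def by blast
  qed
  moreover have "msubgraph A ?C"
    using msubgraph_singleton_medges[OF G sub(1) A(2)] sub(1) A(2) by (simp add: msubgraph_def)
  ultimately have "mcomponent ?C ?H \<and> mcomponent D ?H \<and> ?C \<noteq> D \<and>
      (\<exists>A\<in>S. msubgraph A ?C) \<and> (\<exists>B\<in>S. msubgraph B D)"
    using C D A(1) B(1) by (intro conjI bexI[of _ A] bexI[of _ B])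
  then show ?thesis
    unfolding egg_cut_def by (intro conjI exI[of _ ?C] exI[of _ D]) simp_all
qed

section \<open>Upper bounds on the order, and the size of eggs\<close>

lemma hitting_number_le:
  assumes "loopless_multigraph G" "hitting_set G S X"
  shows "hitting_number G S \<le> card X"
proof -
  have "{card X | X. hitting_set G S X} \<subseteq> card ` Pow (mverts G)"
    by (auto simp: hitting_set_def)
  then have "finite {card X | X. hitting_set G S X}"
    by (rule finite_subset) (use assms(1) in \<open>simp add: loopless_multigraph_def\<close>)
  then show ?thesis
    unfolding hitting_number_def using assms(2) by (intro Min_le) auto
qed

text \<open>The hitting number is finite, so the minimum is never \<infinity> and
  \<open>the_enat\<close> loses nothing.\<close>

lemma enat_scramble_order:
  "enat (scramble_order G S) = min (enat (hitting_number G S)) (egg_cut_number G S)"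
  unfolding scramble_order_def by (cases "egg_cut_number G S") (auto simp: min_def)

lemma scramble_order_le_card_hitting_set:
  assumes "loopless_multigraph G" "hitting_set G S X"
  shows "scramble_order G S \<le> card X"
proof -
  have "enat (scramble_order G S) \<le> enat (hitting_number G S)"
    by (simp only: enat_scramble_order min.cobounded1)
  then show ?thesis
    using hitting_number_le[OF assms] by simp
qed

lemma scramble_order_le_card_egg_cut:
  assumes "egg_cut G S F"
  shows "scramble_order G S \<le> card F"
proof -
  have "enat (scramble_order G S) \<le> egg_cut_number G S"
    by (simp only: enat_scramble_order min.cobounded2)
  also have "\<dots> \<le> enat (card F)"
    unfolding egg_cut_number_def using assms by (intro Inf_lower) auto
  finally show ?thesis
    by simp
qed

lemma mdegree_le_max_mdegree:
  "loopless_multigraph G \<Longrightarrow> v \<in> mverts G \<Longrightarrow> mdegree G v \<le> max_mdegree G"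
  unfolding max_mdegree_def by (intro Max_ge) (auto simp: loopless_multigraph_def)

text \<open>For an egg on \<open>{v}\<close>, the star of \<open>v\<close> has fewer edges than the
  order, so it is no egg-cut and every egg contains \<open>v\<close>. Then \<open>{v}\<close> is a
  hitting set, the order is at most 1, and \<open>v\<close> has degree 0, contradicting
  connectivity.\<close>

lemma card_egg_ge_2:
  assumes G: "loopless_multigraph G" "mconnected G" "card (mverts G) \<noteq> 1"
    and S: "scramble G S" and order: "max_mdegree G < scramble_order G S" and A: "A \<in> S"
  shows "2 \<le> card (mverts A)"
proof (rule ccontr)
  assume "\<not> 2 \<le> card (mverts A)"
  moreover have sub: "mverts A \<subseteq> mverts G" and ne: "mverts A \<noteq> {}"
    using S A by (auto simp: scramble_def msubgraph_def mconnected_def)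
  moreover have "finite (mverts A)"
    using sub G(1) by (auto simp: loopless_multigraph_def intro: finite_subset)
  ultimately have "card (mverts A) = 1"
    by (metis One_nat_def card_0_eq less_2_cases not_le)
  then obtain v where v: "mverts A = {v}"
    by (auto simp: card_1_singleton_iff)
  then have vG: "v \<in> mverts G"
    using sub by simp
  let ?F = "{e \<in> medges G. v \<in> mends G e}"
  have F: "card ?F < scramble_order G S"
    using mdegree_le_max_mdegree[OF G(1) vG] order by (simp add: mdegree_def)
  then have "\<not> egg_cut G S ?F"
    using scramble_order_le_card_egg_cut by fastforce
  then have "\<forall>B\<in>S. v \<in> mverts B"
    using egg_cut_singleton_egg[OF G(1) S A v] by blast
  then have "hitting_set G S {v}"
    using vG by (auto simp: hitting_set_def)
  then have "scramble_order G S \<le> 1"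
    using scramble_order_le_card_hitting_set[OF G(1)] by fastforce
  with F have "card ?F = 0"
    by linarith
  then have "?F = {}"
    using G(1) by (simp add: loopless_multigraph_def)
  \<comment> \<open>The one-vertex graph has to be excluded: there the scramble \<open>{G}\<close>
    has order 1, above the maximum degree 0, and its egg is a single vertex.\<close>
  moreover have "mverts G \<noteq> {v}"
    using G(3) by auto
  ultimately show False
    using mconnected_ex_incident[OF G(2) vG] by blast
qed

section \<open>Attaining the scramble number and the carton number\<close>

lemma scramble_subset: "scramble G S \<Longrightarrow> S \<subseteq> {H. msubgraph H G}"
  unfolding scramble_def by blast

lemma finite_scramble: "loopless_multigraph G \<Longrightarrow> scramble G S \<Longrightarrow> finite S"
  using scramble_subset finite_msubgraphs finite_subset by metis

lemma finite_scrambles: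
  assumes "loopless_multigraph G"
  shows "finite {S. scramble G S}"
proof (rule finite_subset)
  show "{S. scramble G S} \<subseteq> Pow {H. msubgraph H G}"
    using scramble_subset by blast
  show "finite (Pow {H. msubgraph H G})"
    using finite_msubgraphs[OF assms] by simp
qed

text \<open>\<open>Max\<close> and \<open>Min\<close> are attained only on finite nonempty sets:
  there are finitely many scrambles, \<open>{G}\<close> is one of them, and a scramble attaining the
  maximum order makes the second set nonempty.\<close>

lemma ex_scramble_of_carton_number:
  assumes "loopless_multigraph G" "mconnected G"
  shows "\<exists>S. scramble G S \<and> scramble_order G S = scramble_number G \<and> card S = carton_number G"
proof -
  \<comment> \<open>General \<open>f\<close> and \<open>P\<close> cover both the orders of all
    scrambles and the sizes of those of maximum order.\<close>
  have fin: "finite {f S | S. scramble G S \<and> P S}"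
    for f :: "('a, 'b) mgraph set \<Rightarrow> nat" and P
    by (rule finite_subset[OF _ finite_imageI[OF finite_scrambles[OF assms(1)], of f]]) auto
  have "scramble G {G}"
    using assms by (simp add: scramble_def msubgraph_refl)
  then have "scramble_number G \<in> {scramble_order G S | S. scramble G S}"
    unfolding scramble_number_def using fin[of "scramble_order G" "\<lambda>_. True"]
    by (intro Max_in) auto
  then have "{card S | S. scramble G S \<and> scramble_order G S = scramble_number G} \<noteq> {}"
    by force
  then have "carton_number G \<in> {card S | S. scramble G S \<and> scramble_order G S = scramble_number G}"
    unfolding carton_number_def by (intro Min_in fin)
  then show ?thesis
    by force
qed

theorem theorem1p1:
  fixes G :: "('v, 'e) mgraph"
  assumes "loopless_multigraph G"
    and "mconnected G"
    and "card (mverts G) \<noteq> 1"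
    and "max_mdegree G < scramble_number G"
  shows "int (carton_number G) \<ge> 3 * int (scramble_number G) - int (card (mverts G))"
proof -
  obtain S where S: "scramble G S" "scramble_order G S = scramble_number G"
    "card S = carton_number G"
    using ex_scramble_of_carton_number assms by blast
  have "\<forall>A\<in>S. mverts A \<subseteq> mverts G \<and> 2 \<le> card (mverts A)"
    using card_egg_ge_2[OF assms(1-3) S(1)] assms(4) S
    by (auto simp: scramble_def msubgraph_def)
  then obtain X where X: "X \<subseteq> mverts G" "\<forall>A\<in>S. X \<inter> mverts A \<noteq> {}"
    "3 * card X \<le> card (mverts G) + card S"
    using ex_small_transversal[of "mverts G" S mverts] finite_scramble[OF assms(1) S(1)] assms(1)
    by (auto simp: loopless_multigraph_def)
  \<comment> \<open>\<open>X\<close> hits every egg of a scramble of maximum order; tripling this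
    inequality and inserting the bound on \<open>3 * card X\<close> gives the claim.\<close>
  then have "scramble_number G \<le> card X"
    using scramble_order_le_card_hitting_set[OF assms(1), of S X] S(2)
    by (simp add: hitting_set_def)
  with X(3) S(3) show ?thesis
    by linarith
qed

end
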